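(* For every integer $n\ge 4$, the polytope $SATP_{LP}(n,n)$ has a fractional vertex with denominator equal to $n+1$.
   Context: For positive integers $m,n$, points of $\mathbb{R}^{6mn}$ have coordinates $x^{k,l}_{i,j}$ with $k\in\{1,2,3\}$, $l\in\{1,2\}$, $i\in\{1,\dots,m\}$, $j\in\{1,\dots,n\}$. $SATP_{LP}(m,n)\subset\mathbb{R}^{6mn}$ is the polytope of all solutions of the system $$\sum_{k,l}x^{k,l}_{i,j}=1,\qquad x^{1,1}_{i,j}+x^{2,1}_{i,j}+x^{3,1}_{i,j}=x^{1,1}_{i,t}+x^{2,1}_{i,t}+x^{3,1}_{i,t},\qquad x^{k,1}_{i,j}+x^{k,2}_{i,j}=x^{k,1}_{s,j}+x^{k,2}_{s,j},\qquad x^{k,l}_{i,j}\ge 0,$$ for all $k\in\{1,2,3\}$, $l\in\{1,2\}$, $i,s\in\{1,\dots,m\}$, $j,t\in\{1,\dots,n\}$. A vertex is fractional if it is not an integral point. The denominator of a vertex $z$ (which has rational coordinates) is the least common denominator of its coordinates, i.e. the smallest positive integer $d$ such that all coordinates of $dz$ are integers. *)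

theory Defs
  imports "HOL-Analysis.Analysis"
begin

text \<open>
  The coordinate \<open>x\<^sup>k\<^sup>,\<^sup>l\<close> with lower indices \<open>i\<close>, \<open>j\<close> is \<open>x $ (k, l, i, j)\<close>.  The index types \<open>3\<close> and
  \<open>2\<close> have exactly the elements \<open>1, 2, 3\<close> and \<open>1, 2\<close> (arithmetic is modular, so \<open>3 = 0\<close> and
  \<open>2 = 0\<close>, respectively).  The types \<open>'m\<close> and \<open>'n\<close> stand for the index sets of sizes
  \<open>m = CARD('m)\<close> and \<open>n = CARD('n)\<close>, so that the ambient space has dimension \<open>6 m n\<close>.
\<close>

definition SATP_LP :: "(real ^ (3 \<times> 2 \<times> 'm::finite \<times> 'n::finite)) set" where
  "SATP_LP = {x.
     (\<forall>i j. (\<Sum>k\<in>UNIV. \<Sum>l\<in>UNIV. x $ (k, l, i, j)) = 1) \<and>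
     (\<forall>i j t. x $ (1, 1, i, j) + x $ (2, 1, i, j) + x $ (3, 1, i, j)
            = x $ (1, 1, i, t) + x $ (2, 1, i, t) + x $ (3, 1, i, t)) \<and>
     (\<forall>k i s j. x $ (k, 1, i, j) + x $ (k, 2, i, j)
              = x $ (k, 1, s, j) + x $ (k, 2, s, j)) \<and>
     (\<forall>k l i j. 0 \<le> x $ (k, l, i, j))}"

definition integral_point :: "real ^ 'a \<Rightarrow> bool" where
  "integral_point z \<longleftrightarrow> (\<forall>a. z $ a \<in> \<int>)"

definition fractional_vertex :: "real ^ 'a \<Rightarrow> (real ^ 'a) set \<Rightarrow> bool" where
  "fractional_vertex z P \<longleftrightarrow> z extreme_point_of P \<and> \<not> integral_point z"

text \<open>
  A relation rather than a \<open>LEAST\<close>-valued function: a point with an irrational coordinate has no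
  denominator.
\<close>

definition has_denominator :: "real ^ 'a \<Rightarrow> nat \<Rightarrow> bool" where
  "has_denominator z d \<longleftrightarrow>
     0 < d \<and> integral_point (real d *\<^sub>R z) \<and>
     (\<forall>e. 0 < e \<and> integral_point (real e *\<^sub>R z) \<longrightarrow> d \<le> e)"

end

theory Submission
  imports Defs
begin

text \<open>
  In a feasible point, write \<open>q\<^sub>i\<close> for the common sum of the \<open>l = 1\<close> part of the blocks in row \<open>i\<close>, and
  \<open>p\<^sub>j(k) = x\<^sup>k\<^sup>,\<^sup>1 + x\<^sup>k\<^sup>,\<^sup>2\<close> for the common marginal of the blocks in column \<open>j\<close>.  A block in which every
  \<open>x\<^sup>k\<^sup>,\<^sup>1\<close> is \<open>0\<close> or \<open>p\<^sub>j(k)\<close> imposes a linear equation between \<open>q\<^sub>i\<close> and \<open>p\<^sub>j\<close>; together with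
  \<open>p\<^sub>j(1) + p\<^sub>j(2) + p\<^sub>j(3) = 1\<close>, column \<open>j\<close> can thus force one linear relation on the \<open>q\<^sub>i\<close>.
  Zeros are chosen so that the columns \<open>j = 2, \<dots>, n - 1\<close> force \<open>q\<^sub>1 + q\<^sub>j = q\<^sub>j\<^sub>+\<^sub>1\<close>, column \<open>n\<close> forces
  \<open>q\<^sub>1 + q\<^sub>n = 1\<close>, and column \<open>1\<close> forces \<open>q\<^sub>2 + q\<^sub>n\<^sub>-\<^sub>1 = 1\<close>.  The unique solution is
  \<open>q\<^sub>i = i / (n + 1)\<close>.  In all other blocks two of the three \<open>x\<^sup>k\<^sup>,\<^sup>1\<close> are still \<open>0\<close> or \<open>p\<^sub>j(k)\<close>, so the
  whole point is determined by its zero coordinates and hence is a vertex.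
\<close>

definition triple :: "'a \<Rightarrow> 'a \<Rightarrow> 'a \<Rightarrow> 3 \<Rightarrow> 'a" where
  "triple a b c k = (if k = 1 then a else if k = 2 then b else c)"

lemma triple_simps [simp]:
  "triple a b c 1 = a" "triple a b c 2 = b" "triple a b c 3 = c"
  by (simp_all add: triple_def)

text \<open>The next three definitions describe the vertex multiplied by \<open>n + 1\<close>, with indices in \<open>{1..n}\<close>.\<close>

definition marginal :: "nat \<Rightarrow> nat \<Rightarrow> 3 \<Rightarrow> int" where
  "marginal n j = (if j = 1 then triple 2 (int n - 1) 0 else triple 1 (int j) (int n - int j))"

definition left_entry :: "nat \<Rightarrow> nat \<Rightarrow> nat \<Rightarrow> 3 \<Rightarrow> int" where
  "left_entry n i j =
     (if j = 1
      then if i = 2 then triple 2 0 0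
           else if i = n then triple 1 (int n - 1) 0
           else triple 0 (int i) 0
      else if i = 1 then triple 1 0 0
           else if i \<le> j then triple 0 (int i) 0
           else triple 1 (int j) (int i - int j - 1))"

definition entry :: "nat \<Rightarrow> 3 \<Rightarrow> 2 \<Rightarrow> nat \<Rightarrow> nat \<Rightarrow> int" where
  "entry n k l i j = (if l = 1 then left_entry n i j k else marginal n j k - left_entry n i j k)"

lemma marginal_sum: "marginal n j 1 + marginal n j 2 + marginal n j 3 = int n + 1"
  by (simp add: marginal_def)

lemma left_entry_sum:
  "left_entry n i j 1 + left_entry n i j 2 + left_entry n i j 3 = int i"
  by (auto simp: left_entry_def)

lemma entry_nonneg:
  assumes "4 \<le> n" "i \<in> {1..n}" "j \<in> {1..n}"
  shows "0 \<le> entry n k l i j"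
  using assms exhaust_3[of k]
  by (auto simp: entry_def left_entry_def marginal_def)

text \<open>Serves to show extremality: a feasible point that vanishes wherever the vertex does must
  equal it. Rows and columns are numbered by naturals so that the recursion for \<open>q\<close> can
  run by induction.\<close>

lemma entry_unique:
  fixes y :: "3 \<Rightarrow> 2 \<Rightarrow> nat \<Rightarrow> nat \<Rightarrow> real"
  assumes n: "4 \<le> n"
    and total: "\<And>i j. i \<in> {1..n} \<Longrightarrow> j \<in> {1..n} \<Longrightarrow> (\<Sum>k\<in>UNIV. \<Sum>l\<in>UNIV. y k l i j) = 1"
    and left: "\<And>i j t. i \<in> {1..n} \<Longrightarrow> j \<in> {1..n} \<Longrightarrow> t \<in> {1..n} \<Longrightarrow>
      y 1 1 i j + y 2 1 i j + y 3 1 i j = y 1 1 i t + y 2 1 i t + y 3 1 i t"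
    and rows: "\<And>k i s j. i \<in> {1..n} \<Longrightarrow> s \<in> {1..n} \<Longrightarrow> j \<in> {1..n} \<Longrightarrow>
      y k 1 i j + y k 2 i j = y k 1 s j + y k 2 s j"
    and support: "\<And>k l i j. i \<in> {1..n} \<Longrightarrow> j \<in> {1..n} \<Longrightarrow> entry n k l i j = 0 \<Longrightarrow> y k l i j = 0"
    and ij: "i \<in> {1..n}" "j \<in> {1..n}"
  shows "y k l i j = of_int (entry n k l i j) / (real n + 1)"
proof -
  define p where "p j k = y k 1 1 j + y k 2 1 j" for j k
  define q where "q i = y 1 1 i 1 + y 2 1 i 1 + y 3 1 i 1" for i
  define s where "s = q 1"
  have p: "y k 1 i j + y k 2 i j = p j k" if "i \<in> {1..n}" "j \<in> {1..n}" for i j k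
    unfolding p_def by (rule rows) (use that n in auto)
  have q: "y 1 1 i j + y 2 1 i j + y 3 1 i j = q i" if "i \<in> {1..n}" "j \<in> {1..n}" for i j
    unfolding q_def by (rule left) (use that n in auto)
  have p_sum: "p j 1 + p j 2 + p j 3 = 1" if "j \<in> {1..n}" for j
    using total[of 1 j] n that by (simp add: p_def sum_3 sum_2)
  note blk = entry_def left_entry_def marginal_def
  \<comment> \<open>In column \<open>j\<close>, the zeros of the blocks in rows \<open>1\<close>,
    \<open>j\<close> and \<open>Suc j\<close> reduce their \<open>l = 1\<close> sums to
    \<open>p j 1\<close>, \<open>p j 2\<close> and \<open>p j 1 + p j 2\<close>.\<close>
  have p1: "p j 1 = s" if "j \<in> {2..n}" for j
    using p[of 1 j 1] q[of 1 j] support[of 1 j 1 2] support[of 1 j 2 1] support[of 1 j 3 1] that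
    by (simp add: s_def blk)
  have p2: "p j 2 = q j" if "j \<in> {2..n}" for j
    using p[of j j 2] q[of j j] support[of j j 2 2] support[of j j 1 1] support[of j j 3 1] that
    by (simp add: blk)
  have step: "q (Suc j) = s + q j" if "j \<in> {2..<n}" for j
    using p[of "Suc j" j 1] p[of "Suc j" j 2] p1[of j] p2[of j] q[of "Suc j" j]
      support[of "Suc j" j 1 2] support[of "Suc j" j 2 2] support[of "Suc j" j 3 1] that
    by (simp add: blk)
  have q_arith: "j \<le> n \<Longrightarrow> q j = q 2 + (real j - 2) * s" if "2 \<le> j" for j
    using that by (induction j rule: dec_induct) (auto simp: step algebra_simps)
  \<comment> \<open>With no row \<open>Suc n\<close>, the vanishing third marginal closes the
    recursion.\<close>
  have p3n: "p n 3 = 0"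
    using p[of 1 n 3] support[of 1 n 3 1] support[of 1 n 3 2] n by (simp add: blk)
  have e1: "s + q n = 1"
    using p_sum[of n] p1[of n] p2[of n] p3n n by simp
  have p31: "p 1 3 = 0"
    using p[of 1 1 3] support[of 1 1 3 1] support[of 1 1 3 2] n by (simp add: blk)
  have p11: "p 1 1 = q 2"
    using p[of 2 1 1] q[of 2 1] support[of 2 1 1 2] support[of 2 1 2 1] support[of 2 1 3 1] n
    by (simp add: blk)
  \<comment> \<open>For \<open>n = 3\<close> rows \<open>2\<close> and \<open>n - 1\<close>, which
    read off the two nonzero marginals of column \<open>1\<close>, would coincide.\<close>
  have n1: "n - 1 \<in> {1..n}" "n - 1 \<noteq> 2" "n - 1 \<noteq> n"
    using n by auto
  have p21: "p 1 2 = q (n - 1)"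
    using p[of "n-1" 1 2] q[of "n-1" 1] support[of "n-1" 1 1 1] support[of "n-1" 1 2 2]
      support[of "n-1" 1 3 1] n n1
    by (simp add: blk of_nat_diff)
  have e2: "q 2 + q (n - 1) = 1"
    using p_sum[of 1] p11 p21 p31 n by simp
  have e1': "s + q 2 + (real n - 2) * s = 1"
    using e1 q_arith[of n] n by simp
  have e2': "2 * q 2 + (real n - 3) * s = 1"
    using e2 q_arith[of "n-1"] n by (simp add: of_nat_diff)
  \<comment> \<open>Twice \<open>e1'\<close> minus \<open>e2'\<close>; this is the origin of the
    denominator.\<close>
  have s: "(real n + 1) * s = 1" and q2: "q 2 = 2 * s"
    using e1' e2' by (simp_all add: algebra_simps)
  have s_eq: "s = 1 / (real n + 1)"
    using s by (simp add: field_simps)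
  have q_eq: "q i = real i * s" if "i \<in> {1..n}" for i
  proof (cases "i = 1")
    case False
    then show ?thesis using q_arith[of i] q2 that by (simp add: algebra_simps)
  qed (simp add: s_def)
  have p_eq: "p j k = of_int (marginal n j k) * s" if "j \<in> {1..n}" for j k
  proof (cases "j = 1")
    case True
    then show ?thesis
      using exhaust_3[of k] p11 p21 p31 q2 q_eq[of "n-1"] n
      by (auto simp: marginal_def of_nat_diff)
  next
    case False
    then show ?thesis
      using exhaust_3[of k] p1[of j] p2[of j] p_sum[of j] q_eq[of j] s that
      by (auto simp: marginal_def algebra_simps)
  qed
  \<comment> \<open>If \<open>k\<close> is tight, one of its two entries is zero, so
    \<open>support\<close> fixes both. Two tight indices suffice, as the \<open>l = 1\<close> sum
    fixes the third.\<close>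
  define tight where "tight k \<longleftrightarrow> left_entry n i j k \<in> {0, marginal n j k}" for k
  have tight: "y k 1 i j = of_int (left_entry n i j k) * s" if "tight k" for k
    using that support[OF ij, of k 1] support[OF ij, of k 2] p[OF ij, of k] p_eq[OF ij(2), of k]
    by (auto simp: tight_def entry_def)
  have two_tight: "tight 1 \<and> tight 2 \<or> tight 1 \<and> tight 3 \<or> tight 2 \<and> tight 3"
    using ij by (auto simp: tight_def left_entry_def marginal_def)
  have left_sum: "y 1 1 i j + y 2 1 i j + y 3 1 i j =
      of_int (left_entry n i j 1) * s + of_int (left_entry n i j 2) * s
      + of_int (left_entry n i j 3) * s"
    using q[OF ij] q_eq[OF ij(1)] left_entry_sum[of n i j]
    by (metis distrib_right of_int_add of_int_of_nat_eq)
  have left_eq: "y k 1 i j = of_int (left_entry n i j k) * s"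
    using exhaust_3[of k]
  proof (elim disjE)
    assume "k = 1"
    then show ?thesis using two_tight tight[of 1] tight[of 2] tight[of 3] left_sum by auto
  next
    assume "k = 2"
    then show ?thesis using two_tight tight[of 1] tight[of 2] tight[of 3] left_sum by auto
  next
    assume "k = 3"
    then show ?thesis using two_tight tight[of 1] tight[of 2] tight[of 3] left_sum by auto
  qed
  have "y k 2 i j = p j k - y k 1 i j"
    using p[OF ij, of k] by simp
  also have "\<dots> = of_int (entry n k 2 i j) * s"
    using left_eq p_eq[OF ij(2), of k] by (simp add: entry_def left_diff_distrib)
  finally have "y k l i j = of_int (entry n k l i j) * s"
    using exhaust_2[of l] left_eq by (auto simp: entry_def)
  then show ?thesis by (simp add: s_eq)
qed

theorem theorem17:
  assumes "CARD('n::finite) \<ge> 4"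
  shows "\<exists>z :: real ^ (3 \<times> 2 \<times> 'n \<times> 'n).
           fractional_vertex z SATP_LP \<and> has_denominator z (CARD('n) + 1)"
proof -
  define n where "n = CARD('n)"
  have n: "4 \<le> n" using assms by (simp add: n_def)
  obtain f :: "'n \<Rightarrow> nat" where f: "bij_betw f UNIV {1..n}"
    using finite_same_card_bij[of "UNIV :: 'n set" "{1..n}"] unfolding n_def
    by (metis card_atLeastAtMost diff_Suc_1 finite finite_atLeastAtMost)
  define g where "g = inv f"
  have f_range: "f i \<in> {1..n}" for i using f by (auto dest: bij_betwE)
  have fg: "f (g a) = a" if "a \<in> {1..n}" for a
    using f that unfolding g_def by (metis bij_betw_inv_into_right)
  have gf: "g (f i) = i" for i
    using f unfolding g_def by (meson UNIV_I bij_betw_inv_into_left)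
  define z :: "real ^ (3 \<times> 2 \<times> 'n \<times> 'n)" where
    "z = (\<chi> a. case a of (k, l, i, j) \<Rightarrow>
      of_int (entry n k l (f i) (f j)) / (real n + 1))"
  have z: "z $ (k, l, i, j) = of_int (entry n k l (f i) (f j)) / (real n + 1)" for k l i j
    by (simp add: z_def)
  have sum_real: "real_of_int (marginal n b 1) + marginal n b 2 + marginal n b 3 = real n + 1"
    "real_of_int (left_entry n a b 1) + left_entry n a b 2 + left_entry n a b 3 = real a" for a b
    using arg_cong[OF marginal_sum[of n b], of real_of_int]
      arg_cong[OF left_entry_sum[of n a b], of real_of_int] by simp_all
  have mem: "z \<in> SATP_LP"
    unfolding SATP_LP_def mem_Collect_eq
  proof (intro conjI allI)
    fix i j
    show "(\<Sum>k\<in>UNIV. \<Sum>l\<in>UNIV. z $ (k, l, i, j)) = 1"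
      using sum_real(1)[of "f j"]
      by (simp add: z sum_3 sum_2 entry_def flip: add_divide_distrib)
  next
    fix i j t
    show "z $ (1, 1, i, j) + z $ (2, 1, i, j) + z $ (3, 1, i, j)
        = z $ (1, 1, i, t) + z $ (2, 1, i, t) + z $ (3, 1, i, t)"
      by (simp add: z entry_def sum_real flip: add_divide_distrib)
  next
    fix k i s j
    show "z $ (k, 1, i, j) + z $ (k, 2, i, j) = z $ (k, 1, s, j) + z $ (k, 2, s, j)"
      by (simp add: z entry_def flip: add_divide_distrib)
  next
    fix k l i j
    show "0 \<le> z $ (k, l, i, j)"
      using entry_nonneg[OF n f_range f_range] by (simp add: z)
  qed
  have unique: "y = z"
    if y: "y \<in> SATP_LP" and supp: "\<And>a. z $ a = 0 \<Longrightarrow> y $ a = 0" for y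
  proof -
    have "y $ (k, l, g a, g b) = of_int (entry n k l a b) / (real n + 1)"
      if "a \<in> {1..n}" "b \<in> {1..n}" for k l a b
    proof (rule entry_unique[OF n _ _ _ _ that, where y = "\<lambda>k l a b. y $ (k, l, g a, g b)"])
      fix k l a b assume "a \<in> {1..n}" "b \<in> {1..n}" "entry n k l a b = 0"
      then show "y $ (k, l, g a, g b) = 0" by (intro supp) (simp add: z fg)
    qed (use y in \<open>auto simp: SATP_LP_def\<close>)
    from this[OF f_range f_range] show ?thesis
      by (simp add: vec_eq_iff z gf)
  qed
  have extreme: "z extreme_point_of SATP_LP"
    unfolding extreme_point_of_def
  proof (intro conjI mem ballI notI)
    fix a b :: "real ^ (3 \<times> 2 \<times> 'n \<times> 'n)"
    assume ab: "a \<in> SATP_LP" "b \<in> SATP_LP" and "z \<in> open_segment a b"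
    then obtain u where "a \<noteq> b" and u: "0 < u" "u < 1" and zu: "z = (1 - u) *\<^sub>R a + u *\<^sub>R b"
      by (auto simp: in_segment)
    \<comment> \<open>A convex combination of nonnegative numbers with positive weights is zero only
      if both are.\<close>
    have "a $ c = 0 \<and> b $ c = 0" if "z $ c = 0" for c
    proof -
      have "0 \<le> a $ c" "0 \<le> b $ c"
        using ab by (cases c; simp add: SATP_LP_def)+
      moreover have "(1 - u) * a $ c + u * b $ c = 0"
        using that by (simp add: zu)
      ultimately show ?thesis
        using u by (simp add: add_nonneg_eq_0_iff)
    qed
    then have "a = z" "b = z" using ab unique by blast+
    with \<open>a \<noteq> b\<close> show False by simp
  qed
  \<comment> \<open>A coordinate with numerator \<open>1\<close> forces every common denominator to
    be a multiple of \<open>n + 1\<close>.\<close>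
  have zc: "z $ (2, 1, g 1, g 1) = 1 / (real n + 1)"
    using n by (simp add: z fg entry_def left_entry_def)
  have lower: "n + 1 \<le> e" if "0 < e" "integral_point (real e *\<^sub>R z)" for e
  proof -
    have "real e / (real n + 1) \<in> \<int>"
      using that(2) zc unfolding integral_point_def
      by (metis times_divide_eq_right mult.right_neutral vector_scaleR_component real_scaleR_def)
    then obtain m where "real e / (real n + 1) = of_int m" by (auto elim: Ints_cases)
    then have m: "real e = of_int m * (real n + 1)" by (simp add: field_simps)
    then have "real_of_int (int e) = real_of_int (m * (int n + 1))"
      by simp
    then have "int e = m * (int n + 1)"
      by (simp only: of_int_eq_iff)
    then have "(n + 1) dvd e"
      using int_dvd_int_iff[of "n + 1" e] by (simp add: add.commute)
    with that(1) show ?thesis by (simp add: dvd_imp_le)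
  qed
  have "(real n + 1) * (x / (real n + 1)) = x" for x
    by simp
  then have "integral_point (real (n + 1) *\<^sub>R z)"
    by (simp add: integral_point_def z add.commute del: times_divide_eq_right)
  with lower have "has_denominator z (n + 1)"
    by (simp add: has_denominator_def)
  \<comment> \<open>Integrality would make \<open>1\<close> a common denominator.\<close>
  moreover have "\<not> integral_point z"
    using lower[of 1] n by auto
  ultimately show ?thesis
    using extreme unfolding fractional_vertex_def n_def by blast
qed

end
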